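(* Let $L$ be an MTL-algebra, let $\mu$ be a fuzzy set of $L$, and let $(F,A)$ be the $\in$-soft set over $L$ determined by $\mu$ with $A=(\alpha,\beta]\subseteq(0,1]$, where $\alpha<\beta$. Then $(F,A)$ is a Boolean filteristic soft MTL-algebra over $L$ if and only if it is both an MV-filteristic soft MTL-algebra over $L$ and a G-filteristic soft MTL-algebra over $L$.
   Context: An MTL-algebra is a lattice $(L,\le,\wedge,\vee)$ with least element $0$ and largest element $1\neq 0$, with two binary operations $\odot,\rightarrow$ such that: $\odot$ is associative, commutative and isotone; $x\odot 1=x$; $x\odot y\le z\iff x\le y\rightarrow z$; and $(x\rightarrow y)\vee(y\rightarrow x)=1$, for all $x,y,z\in L$. Write $x'=x\rightarrow 0$. A filter of $L$ is a non-empty subset $G\subseteq L$ closed under $\odot$ and such that $x\in G$, $x\le y$ imply $y\in G$. A filter $G$ is: a Boolean filter if $x\vee x'\in G$ for all $x\in L$; a G-filter if for all $x,y\in L$, $(x\odot x)\rightarrow y\in G$ implies $x\rightarrow y\in G$; an MV-filter if for all $x,y\in L$, $x\rightarrow y\in G$ implies $((y\rightarrow x)\rightarrow x)\rightarrow y\in G$. A fuzzy set of $L$ is a function $\mu:L\to[0,1]$. A soft set over $L$ is a pair $(F,A)$ with $F:A\to\mathcal P(L)$. For $A\subseteq[0,1]$, the $\in$-soft set over $L$ determined by $\mu$ is $(F,A)$ with $F(t)=\{x\in L\mid \mu(x)\ge t\}$ for $t\in A$. A soft set $(F,A)$ over $L$ is a Boolean (respectively G-, MV-) filteristic soft MTL-algebra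 over $L$ if $F(t)$ is a Boolean filter (respectively G-filter, MV-filter) of $L$ for all $t\in A$, where by convention the empty set is regarded as a Boolean filter (respectively G-filter, MV-filter). *)

theory Defs
  imports Complex_Main
begin

text \<open>
  The least element 0 and the largest element 1 of the algebra are \<^const>\<open>bot\<close> and \<^const>\<open>top\<close>.
\<close>

class mtl_algebra = bounded_lattice +
  fixes mtl_mult :: "'a \<Rightarrow> 'a \<Rightarrow> 'a"  (infixl "\<odot>" 70)
    and mtl_imp :: "'a \<Rightarrow> 'a \<Rightarrow> 'a"  (infixr "\<^bold>\<rightarrow>" 60)
  assumes mtl_mult_assoc: "(x \<odot> y) \<odot> z = x \<odot> (y \<odot> z)"
    and mtl_mult_commute: "x \<odot> y = y \<odot> x"
    and mtl_mult_isotone: "x \<le> y \<Longrightarrow> x \<odot> z \<le> y \<odot> z"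
    and mtl_mult_top: "x \<odot> top = x"
    and mtl_residuation: "x \<odot> y \<le> z \<longleftrightarrow> x \<le> (y \<^bold>\<rightarrow> z)"
    and mtl_prelinearity: "sup (x \<^bold>\<rightarrow> y) (y \<^bold>\<rightarrow> x) = top"
    and mtl_top_neq_bot: "top \<noteq> bot"

definition mtl_neg :: "'a::mtl_algebra \<Rightarrow> 'a" where
  "mtl_neg x = (x \<^bold>\<rightarrow> bot)"

definition mtl_filter :: "'a::mtl_algebra set \<Rightarrow> bool" where
  "mtl_filter G \<longleftrightarrow> G \<noteq> {} \<and> (\<forall>x\<in>G. \<forall>y\<in>G. x \<odot> y \<in> G) \<and> (\<forall>x\<in>G. \<forall>y. x \<le> y \<longrightarrow> y \<in> G)"

definition boolean_filter :: "'a::mtl_algebra set \<Rightarrow> bool" where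
  "boolean_filter G \<longleftrightarrow> mtl_filter G \<and> (\<forall>x. sup x (mtl_neg x) \<in> G)"

definition G_filter :: "'a::mtl_algebra set \<Rightarrow> bool" where
  "G_filter G \<longleftrightarrow> mtl_filter G \<and> (\<forall>x y. ((x \<odot> x) \<^bold>\<rightarrow> y) \<in> G \<longrightarrow> (x \<^bold>\<rightarrow> y) \<in> G)"

definition MV_filter :: "'a::mtl_algebra set \<Rightarrow> bool" where
  "MV_filter G \<longleftrightarrow> mtl_filter G \<and>
     (\<forall>x y. (x \<^bold>\<rightarrow> y) \<in> G \<longrightarrow> (((y \<^bold>\<rightarrow> x) \<^bold>\<rightarrow> x) \<^bold>\<rightarrow> y) \<in> G)"

definition fuzzy_set :: "('a \<Rightarrow> real) \<Rightarrow> bool" where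
  "fuzzy_set \<mu> \<longleftrightarrow> (\<forall>x. \<mu> x \<in> {0..1})"

text \<open>
  A soft set \<open>(F, A)\<close> consists of a set \<open>A\<close> of parameters and a map \<open>F\<close> on \<open>A\<close>. Here \<open>F\<close> is a
  total function whose values outside \<open>A\<close> carry no information; no notion below inspects them.
\<close>

type_synonym ('p, 'a) soft_set = "('p \<Rightarrow> 'a set) \<times> 'p set"

definition in_soft_set :: "('a \<Rightarrow> real) \<Rightarrow> real set \<Rightarrow> (real, 'a) soft_set" where
  "in_soft_set \<mu> A = (\<lambda>t. {x. \<mu> x \<ge> t}, A)"

text \<open>
  The disjunct \<open>F t = {}\<close> is the convention that the empty set counts as a Boolean (G-, MV-)
  filter, although a filter is non-empty by definition.
\<close>

definition boolean_filteristic :: "('p, 'a::mtl_algebra) soft_set \<Rightarrow> bool" where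
  "boolean_filteristic = (\<lambda>(F, A). \<forall>t\<in>A. F t = {} \<or> boolean_filter (F t))"

definition G_filteristic :: "('p, 'a::mtl_algebra) soft_set \<Rightarrow> bool" where
  "G_filteristic = (\<lambda>(F, A). \<forall>t\<in>A. F t = {} \<or> G_filter (F t))"

definition MV_filteristic :: "('p, 'a::mtl_algebra) soft_set \<Rightarrow> bool" where
  "MV_filteristic = (\<lambda>(F, A). \<forall>t\<in>A. F t = {} \<or> MV_filter (F t))"

end

theory Submission
  imports Defs
begin

text \<open>
  The equivalence holds for each filter \<open>G\<close> separately
  (\<open>boolean_filter_iff_MV_filter_and_G_filter\<close>), and hence for every family of level sets.

  If \<open>G\<close> is Boolean, the G- and MV-implications are excluded-middle arguments: to derive \<open>w \<in> G\<close>
  from \<open>h \<in> G\<close> it suffices to show \<open>a \<odot> h \<le> w\<close> and \<open>a' \<odot> h \<le> w\<close> for some \<open>a\<close>, since \<open>\<odot>\<close>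
  distributes over joins. For the G-property the case distinction is on the antecedent \<open>x\<close>, for
  the MV-property on the consequent \<open>y\<close>.

  Conversely, put \<open>s = x \<or> x'\<close>. Its negation lies below both \<open>x'\<close> and \<open>x''\<close>, so
  \<open>s' \<odot> s' = 0\<close>, and the G-property turns \<open>s' \<odot> s' \<rightarrow> 0 = 1 \<in> G\<close> into \<open>s'' \<in> G\<close>. The MV-property
  applied to \<open>0 \<rightarrow> s\<close> says that double negation may be eliminated modulo \<open>G\<close>, that is,
  \<open>s'' \<rightarrow> s \<in> G\<close>. Modus ponens gives \<open>s \<in> G\<close>.
\<close>

lemma mtl_mult_mono:
  fixes a b c d :: "'a::mtl_algebra"
  assumes "a \<le> b" "c \<le> d"
  shows "a \<odot> c \<le> b \<odot> d"
  by (metis assms mtl_mult_commute mtl_mult_isotone order_trans)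

lemma mtl_mult_le_left: "a \<odot> b \<le> (a::'a::mtl_algebra)"
  by (metis mtl_mult_mono mtl_mult_top order_refl top_greatest)

lemma mtl_modus_ponens: "(a \<^bold>\<rightarrow> b) \<odot> a \<le> (b::'a::mtl_algebra)"
  by (simp add: mtl_residuation)

lemma mtl_neg_mult_self: "mtl_neg a \<odot> a = (bot::'a::mtl_algebra)"
  unfolding mtl_neg_def by (rule bot_unique[THEN iffD1], rule mtl_modus_ponens)

lemma mtl_imp_eq_top: "a \<le> b \<Longrightarrow> (a \<^bold>\<rightarrow> b) = (top::'a::mtl_algebra)"
  by (metis mtl_mult_commute mtl_mult_top mtl_residuation top_unique)

lemma mtl_imp_mono_right: "b \<le> c \<Longrightarrow> (a \<^bold>\<rightarrow> b) \<le> (a \<^bold>\<rightarrow> (c::'a::mtl_algebra))"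
  by (meson mtl_modus_ponens mtl_residuation order_trans)

lemma mtl_neg_antimono:
  assumes "a \<le> (b::'a::mtl_algebra)"
  shows "mtl_neg b \<le> mtl_neg a"
proof -
  have "mtl_neg b \<odot> a \<le> mtl_neg b \<odot> b"
    using assms by (intro mtl_mult_mono) auto
  then show ?thesis
    by (simp add: mtl_neg_mult_self mtl_neg_def[of a] flip: mtl_residuation)
qed

text \<open>
  Multiplication by a fixed element is a left adjoint by residuation, so it preserves joins; this
  is the half of distributivity that case distinctions use.
\<close>
lemma sup_mult_le:
  fixes a b h w :: "'a::mtl_algebra"
  assumes "a \<odot> h \<le> w" "b \<odot> h \<le> w"
  shows "sup a b \<odot> h \<le> w"
  using assms by (simp add: mtl_residuation)

lemma mtl_filter_top: "mtl_filter G \<Longrightarrow> top \<in> G"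
  unfolding mtl_filter_def by (metis ex_in_conv top_greatest)

lemma mtl_filter_mult_le:
  "mtl_filter G \<Longrightarrow> a \<in> G \<Longrightarrow> b \<in> G \<Longrightarrow> a \<odot> b \<le> c \<Longrightarrow> c \<in> G"
  unfolding mtl_filter_def by blast

lemma boolean_filter_cases:
  assumes "boolean_filter G" "h \<in> G" "a \<odot> h \<le> w" "mtl_neg a \<odot> h \<le> w"
  shows "w \<in> G"
proof (rule mtl_filter_mult_le)
  show "mtl_filter G" "sup a (mtl_neg a) \<in> G" "h \<in> G"
    using assms by (auto simp: boolean_filter_def)
  show "sup a (mtl_neg a) \<odot> h \<le> w"
    using assms by (intro sup_mult_le)
qed

text \<open>
  Under \<open>x\<close> one factor of \<open>x \<odot> x\<close> in the hypothesis is available for free; under \<open>x'\<close> the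
  conclusion \<open>x \<rightarrow> y\<close> holds vacuously.
\<close>
lemma boolean_filter_imp_G_filter:
  assumes "boolean_filter G"
  shows "G_filter G"
  unfolding G_filter_def
proof (intro conjI allI impI)
  show "mtl_filter G"
    using assms by (simp add: boolean_filter_def)
  fix x y
  assume h: "((x \<odot> x) \<^bold>\<rightarrow> y) \<in> G"
  show "(x \<^bold>\<rightarrow> y) \<in> G"
  proof (rule boolean_filter_cases[OF assms h])
    have "((x \<odot> x) \<^bold>\<rightarrow> y) \<odot> (x \<odot> x) \<le> y"
      by (rule mtl_modus_ponens)
    then show "x \<odot> ((x \<odot> x) \<^bold>\<rightarrow> y) \<le> (x \<^bold>\<rightarrow> y)"
      by (metis mtl_mult_assoc mtl_mult_commute mtl_residuation)
    have "mtl_neg x \<le> (x \<^bold>\<rightarrow> y)"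
      unfolding mtl_neg_def by (rule mtl_imp_mono_right) simp
    then show "mtl_neg x \<odot> ((x \<odot> x) \<^bold>\<rightarrow> y) \<le> (x \<^bold>\<rightarrow> y)"
      using mtl_mult_le_left order_trans by blast
  qed
qed

text \<open>
  Under \<open>y\<close> the conclusion holds trivially. Under \<open>y'\<close> the implication \<open>y \<rightarrow> x\<close> holds vacuously,
  so \<open>(y \<rightarrow> x) \<rightarrow> x\<close> yields \<open>x\<close>, and the hypothesis \<open>x \<rightarrow> y\<close> yields \<open>y\<close>.
\<close>
lemma boolean_filter_imp_MV_filter:
  assumes "boolean_filter G"
  shows "MV_filter G"
  unfolding MV_filter_def
proof (intro conjI allI impI)
  show "mtl_filter G"
    using assms by (simp add: boolean_filter_def)
  fix x y
  assume h: "(x \<^bold>\<rightarrow> y) \<in> G"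
  let ?p = "(y \<^bold>\<rightarrow> x) \<^bold>\<rightarrow> x"
  show "(?p \<^bold>\<rightarrow> y) \<in> G"
  proof (rule boolean_filter_cases[OF assms h])
    have "(y \<odot> (x \<^bold>\<rightarrow> y)) \<odot> ?p \<le> y"
      using mtl_mult_le_left order_trans by blast
    then show "y \<odot> (x \<^bold>\<rightarrow> y) \<le> (?p \<^bold>\<rightarrow> y)"
      by (simp add: mtl_residuation)
    have "mtl_neg y \<le> (y \<^bold>\<rightarrow> x)"
      unfolding mtl_neg_def by (rule mtl_imp_mono_right) simp
    then have "?p \<odot> mtl_neg y \<le> ?p \<odot> (y \<^bold>\<rightarrow> x)"
      by (intro mtl_mult_mono) auto
    also have "\<dots> \<le> x"
      by (rule mtl_modus_ponens)
    finally have "(x \<^bold>\<rightarrow> y) \<odot> (?p \<odot> mtl_neg y) \<le> (x \<^bold>\<rightarrow> y) \<odot> x"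
      by (intro mtl_mult_mono) auto
    also have "\<dots> \<le> y"
      by (rule mtl_modus_ponens)
    finally have "(mtl_neg y \<odot> (x \<^bold>\<rightarrow> y)) \<odot> ?p \<le> y"
      by (metis mtl_mult_assoc mtl_mult_commute)
    then show "mtl_neg y \<odot> (x \<^bold>\<rightarrow> y) \<le> (?p \<^bold>\<rightarrow> y)"
      by (simp add: mtl_residuation)
  qed
qed

lemma G_filter_neg_of_square_zero:
  assumes "G_filter G" "a \<odot> a = bot"
  shows "mtl_neg a \<in> G"
proof -
  have "((a \<odot> a) \<^bold>\<rightarrow> bot) \<in> G"
    using assms by (simp add: G_filter_def mtl_filter_top mtl_imp_eq_top)
  then show ?thesis
    using assms(1) unfolding G_filter_def mtl_neg_def by blast
qed

lemma MV_filter_double_neg_elim: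
  assumes "MV_filter G"
  shows "(mtl_neg (mtl_neg a) \<^bold>\<rightarrow> a) \<in> G"
proof -
  have "(bot \<^bold>\<rightarrow> a) \<in> G"
    using assms by (simp add: MV_filter_def mtl_filter_top mtl_imp_eq_top)
  then show ?thesis
    using assms unfolding MV_filter_def mtl_neg_def by blast
qed

lemma mtl_neg_excluded_middle_square:
  fixes x :: "'a::mtl_algebra"
  shows "mtl_neg (sup x (mtl_neg x)) \<odot> mtl_neg (sup x (mtl_neg x)) = bot"
proof -
  let ?n = "mtl_neg (sup x (mtl_neg x))"
  have "?n \<odot> ?n \<le> mtl_neg (mtl_neg x) \<odot> mtl_neg x"
    by (intro mtl_mult_mono mtl_neg_antimono) auto
  then show ?thesis
    by (simp add: mtl_neg_mult_self bot_unique)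
qed

lemma boolean_filter_iff_MV_filter_and_G_filter:
  "boolean_filter G \<longleftrightarrow> MV_filter G \<and> G_filter G"
proof
  assume "boolean_filter G"
  then show "MV_filter G \<and> G_filter G"
    by (simp add: boolean_filter_imp_MV_filter boolean_filter_imp_G_filter)
next
  assume G: "MV_filter G \<and> G_filter G"
  then have filter: "mtl_filter G"
    by (simp add: MV_filter_def)
  have "sup x (mtl_neg x) \<in> G" for x
  proof -
    let ?s = "sup x (mtl_neg x)"
    have "mtl_neg (mtl_neg ?s) \<in> G"
      using G mtl_neg_excluded_middle_square by (blast intro: G_filter_neg_of_square_zero)
    moreover have "(mtl_neg (mtl_neg ?s) \<^bold>\<rightarrow> ?s) \<in> G"
      using G by (blast intro: MV_filter_double_neg_elim)
    ultimately show ?thesis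
      using filter mtl_filter_mult_le mtl_modus_ponens by blast
  qed
  then show "boolean_filter G"
    using filter by (simp add: boolean_filter_def)
qed

theorem theorem4p3p13:
  fixes \<mu> :: "'a::mtl_algebra \<Rightarrow> real" and \<alpha> \<beta> :: real
  assumes "fuzzy_set \<mu>"
    and "\<alpha> < \<beta>" and "{\<alpha><..\<beta>} \<subseteq> {0<..1}"
  shows "boolean_filteristic (in_soft_set \<mu> {\<alpha><..\<beta>}) \<longleftrightarrow>
    MV_filteristic (in_soft_set \<mu> {\<alpha><..\<beta>}) \<and> G_filteristic (in_soft_set \<mu> {\<alpha><..\<beta>})"
  unfolding boolean_filteristic_def MV_filteristic_def G_filteristic_def in_soft_set_def
    boolean_filter_iff_MV_filter_and_G_filter
  by auto

end
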